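(* Fix an integer $k\ge 2$ and a formal variable $q$. Define formal series $G_s$, $s\ge1$, by $$G_i=\prod_{\substack{n\ge 1\\ n\not\equiv 0,\,\pm(k+1-i)\ (\mathrm{mod}\ 2k+1)}}\frac{1}{1-q^n}\quad (i=1,\dots,k),$$ $$G_{(k-1)j+i}=\frac{G_{(k-1)(j-1)+k-i+1}-G_{(k-1)(j-1)+k-i+2}}{q^{(i-1)j}}\quad (j\ge 1,\ i=2,\dots,k).$$ Then for every $j\ge 0$ and $l=1,\dots,k$, $G_{(k-1)j+l}=\sum_{m\ge0}d(m)q^m$, where $d(m)$ is the number of partitions of $m$ that have difference at least 2 at distance $k-1$, whose smallest part is greater than $j$, and in which $j+1$ appears at most $k-l$ times.
   Context: A partition $m=p_1+\cdots+p_n$ with $p_1\ge\cdots\ge p_n>0$ has difference at least 2 at distance $t$ if $p_s-p_{s+t}\ge 2$ whenever $s\ge 1$ and $s+t\le n$. The empty partition of $0$ is included (its smallest-part condition holding vacuously). *)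

theory Defs
  imports
    "HOL-Analysis.Infinite_Products"
    "HOL-Computational_Algebra.Formal_Laurent_Series"
    "HOL-Number_Theory.Cong"
begin

definition partition_of :: "nat list \<Rightarrow> nat \<Rightarrow> bool" where
  "partition_of ps m \<longleftrightarrow> sorted_wrt (\<ge>) ps \<and> (\<forall>p\<in>set ps. p > 0) \<and> sum_list ps = m"

(* Positions are counted from 0 here; the bound is additive to avoid truncated subtraction. *)
definition diff_two_at_distance :: "nat \<Rightarrow> nat list \<Rightarrow> bool" where
  "diff_two_at_distance t ps \<longleftrightarrow> (\<forall>s. s + t < length ps \<longrightarrow> ps ! s \<ge> ps ! (s + t) + 2)"

(* Parts are listed in decreasing order, so the smallest one is the last. *)
definition gordon_partitions :: "nat \<Rightarrow> nat \<Rightarrow> nat \<Rightarrow> nat \<Rightarrow> nat list set" where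
  "gordon_partitions k j l m =
     {ps. partition_of ps m \<and> diff_two_at_distance (k - 1) ps \<and>
          (ps \<noteq> [] \<longrightarrow> last ps > j) \<and> count_list ps (j + 1) \<le> k - l}"

definition gordon_factor :: "nat \<Rightarrow> nat \<Rightarrow> nat \<Rightarrow> rat fps" where
  "gordon_factor k i n =
     (if [int n = 0] (mod (2 * int k + 1)) \<or>
         [int n = int k + 1 - int i] (mod (2 * int k + 1)) \<or>
         [int n = - (int k + 1 - int i)] (mod (2 * int k + 1))
      then 1 else 1 / (1 - fps_X ^ n))"

(* The limit is taken in the X-adic topology of formal power series;
   gordon_product_has_prod below shows that it exists. *)
definition gordon_product :: "nat \<Rightarrow> nat \<Rightarrow> rat fps" where
  "gordon_product k i = prodinf (\<lambda>n. gordon_factor k i (Suc n))"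

lemma finite_gordon_partitions: "finite (gordon_partitions k j l m)"
proof (rule finite_subset)
  show "gordon_partitions k j l m \<subseteq> {ps. set ps \<subseteq> {..m} \<and> length ps \<le> m}"
  proof
    fix ps assume "ps \<in> gordon_partitions k j l m"
    then have pos: "\<forall>p\<in>set ps. p > 0" and sum: "sum_list ps = m"
      by (auto simp: gordon_partitions_def partition_of_def)
    from pos have "length ps \<le> sum_list ps" by (induction ps) auto
    moreover have "\<forall>p\<in>set ps. p \<le> sum_list ps" by (simp add: member_le_sum_list)
    ultimately show "ps \<in> {ps. set ps \<subseteq> {..m} \<and> length ps \<le> m}" using sum by auto
  qed
qed (rule finite_lists_length_le, simp)

lemma gordon_factor_nth:
  assumes "m < n"
  shows "fps_nth (gordon_factor k i n) m = (if m = 0 then 1 else 0)"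
proof -
  let ?g = "inverse (1 - fps_X ^ n) :: rat fps"
  have nz: "fps_nth (1 - fps_X ^ n :: rat fps) 0 \<noteq> 0" using assms by simp
  have "?g * (1 - fps_X ^ n) = 1" using nz by (rule inverse_mult_eq_1)
  then have "?g = 1 + fps_X ^ n * ?g" by (simp add: algebra_simps)
  then have "fps_nth ?g m = fps_nth (1 + fps_X ^ n * ?g) m" by simp
  also have "\<dots> = (if m = 0 then 1 else 0)" using assms by (simp add: fps_X_power_mult_nth)
  finally have "fps_nth ?g m = (if m = 0 then 1 else 0)" .
  moreover have "1 / (1 - fps_X ^ n) = ?g" using nz by (simp add: fps_divide_unit)
  ultimately show ?thesis by (simp add: gordon_factor_def)
qed

lemma gordon_product_has_prod:
  "(\<lambda>n. gordon_factor k i (Suc n)) has_prod gordon_product k i"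
proof -
  let ?f = "\<lambda>n. gordon_factor k i (Suc n)"
  let ?P = "\<lambda>n. \<Prod>r\<le>n. ?f r"
  define L where "L = Abs_fps (\<lambda>m. fps_nth (?P m) m)"
  have step: "fps_nth (?P (Suc n)) m = fps_nth (?P n) m" if "m \<le> n" for m n
  proof -
    have "fps_nth (?P (Suc n)) m
        = (\<Sum>r=0..m. fps_nth (?P n) r * fps_nth (?f (Suc n)) (m - r))"
      by (simp add: fps_mult_nth)
    also have "\<dots> = (\<Sum>r=0..m. if r = m then fps_nth (?P n) r else 0)"
      by (rule sum.cong) (use that in \<open>auto simp: gordon_factor_nth\<close>)
    finally show ?thesis by simp
  qed
  have const: "fps_nth (?P n) m = fps_nth L m" if "m \<le> n" for m n
    using that by (induction n rule: dec_induct) (auto simp: L_def step simp del: prod.atMost_Suc)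
  have lim: "?P \<longlonglongrightarrow> L"
    by (rule tendsto_fpsI) (use const in \<open>auto intro: eventually_sequentiallyI\<close>)
  have "fps_nth L 0 = 1" by (simp add: L_def gordon_factor_nth)
  then have "L \<noteq> 0" by auto
  with lim have "?f has_prod L" by (simp add: has_prod_def raw_has_prod_def)
  moreover have "?f n \<noteq> 0" for n
    using gordon_factor_nth[of 0 "Suc n" k i] by auto
  then have "p = L" if "?f has_prod p" for p
    using that lim LIMSEQ_unique by (auto simp: has_prod_def raw_has_prod_def)
  ultimately show ?thesis unfolding gordon_product_def prodinf_def by (metis theI)
qed

(* The pairs (j, i) with j >= 1 and 2 <= i <= k are unique coordinates of the indices
   (k - 1) * j + i > k, so the recursion for the series G is satisfiable; the auxiliary function
   (indexed by such pairs, with i = 1 standing for (j - 1, k)) only serves to prove this. *)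
fun gordon_series_aux :: "nat \<Rightarrow> nat \<Rightarrow> nat \<Rightarrow> rat fls" where
  "gordon_series_aux k 0 i = fps_to_fls (gordon_product k i)"
| "gordon_series_aux k (Suc j) i =
     (if i = 1 then gordon_series_aux k j k
      else (gordon_series_aux k j (k - i + 1) - gordon_series_aux k j (k - i + 2))
             / fls_X ^ ((i - 1) * Suc j))"

lemma gordon_series_exists:
  fixes k :: nat
  assumes k: "k \<ge> 2"
  shows "\<exists>G :: nat \<Rightarrow> rat fls.
    (\<forall>i\<in>{1..k}. G i = fps_to_fls (gordon_product k i)) \<and>
    (\<forall>j\<ge>1. \<forall>i\<in>{2..k}. G ((k - 1) * j + i) =
       (G ((k - 1) * (j - 1) + k - i + 1) - G ((k - 1) * (j - 1) + k - i + 2))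
         / fls_X ^ ((i - 1) * j))"
proof -
  define G where "G s = gordon_series_aux k ((s - 1) div (k - 1)) ((s - 1) mod (k - 1) + 1)" for s
  have G: "G ((k - 1) * j + l) = gordon_series_aux k j l" if "l \<in> {1..k}" for j l
  proof (cases "l = k")
    case True
    then have *: "(k - 1) * j + l - 1 = (k - 1) * Suc j" using k by simp
    have "(k - 1) * Suc j div (k - 1) = Suc j" "(k - 1) * Suc j mod (k - 1) + 1 = 1"
      using k by (simp_all del: mult_Suc_right)
    then have "G ((k - 1) * j + l) = gordon_series_aux k (Suc j) 1"
      unfolding G_def * by (simp only:)
    then show ?thesis using True by simp
  next
    case False
    then have l: "l - 1 < k - 1" "l - 1 + 1 = l"
      and *: "(k - 1) * j + l - 1 = (k - 1) * j + (l - 1)"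
      using that by auto
    have "((k - 1) * j + (l - 1)) div (k - 1) = j"
      "((k - 1) * j + (l - 1)) mod (k - 1) = l - 1"
      using l(1) by (simp_all add: div_mult_self4)
    then show ?thesis unfolding G_def * by (simp only: l(2))
  qed
  show ?thesis
  proof (intro exI[of _ G] conjI ballI allI impI)
    fix i assume "i \<in> {1..k}"
    then show "G i = fps_to_fls (gordon_product k i)" using G[of i 0] by simp
  next
    fix j i assume j: "(j::nat) \<ge> 1" and i: "i \<in> {2..k}"
    then obtain j' where j': "j = Suc j'" by (cases j) auto
    have "(k - 1) * (j - 1) + k - i + 1 = (k - 1) * j' + (k - i + 1)"
      "(k - 1) * (j - 1) + k - i + 2 = (k - 1) * j' + (k - i + 2)"
      using i j' by auto
    moreover have "k - i + 1 \<in> {1..k}" "k - i + 2 \<in> {1..k}" "i \<in> {1..k}" "i \<noteq> 1"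
      using i by auto
    ultimately show "G ((k - 1) * j + i) =
       (G ((k - 1) * (j - 1) + k - i + 1) - G ((k - 1) * (j - 1) + k - i + 2))
         / fls_X ^ ((i - 1) * j)"
      using j' by (simp only: G gordon_series_aux.simps if_False)
  qed
qed

end

theory Submission
  imports Defs
begin

text \<open>
Write \<open>R\<^sub>j\<^sub>,\<^sub>i\<close> for the generating function of the partitions counted for \<open>l = k + 1 - i\<close>
(so \<open>j + 1\<close> appears at most \<open>i - 1\<close> times) and \<open>R\<^sub>j\<^sub>,\<^sub>0 = 0\<close>. Removing the parts equal to \<open>j + 1\<close>,
when there are exactly \<open>i - 1\<close> of them, gives
\<open>R\<^sub>j\<^sub>,\<^sub>i = R\<^sub>j\<^sub>,\<^sub>i\<^sub>-\<^sub>1 + q^((j + 1)(i - 1)) R\<^sub>j\<^sub>+\<^sub>1\<^sub>,\<^sub>k\<^sub>-\<^sub>i\<^sub>+\<^sub>1\<close>, which is the recursion defining \<open>G\<close>;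
only the case \<open>j = 0\<close>, Gordon's theorem, remains. Andrews' alternating series \<open>S\<^sub>j\<^sub>,\<^sub>i\<close>, obtained from
his function of \<open>x\<close> by setting \<open>x = q^j\<close> and multiplying by \<open>(q; q)\<^sub>\<infinity>\<close>, satisfies the same recursion.
Both \<open>S\<^sub>j\<^sub>,\<^sub>i\<close> and \<open>(q; q)\<^sub>\<infinity> R\<^sub>j\<^sub>,\<^sub>i\<close> agree with \<open>(q; q)\<^sub>\<infinity>\<close> up to order \<open>q^j\<close>, and this
determines a solution of the recursion, so they are equal; and \<open>S\<^sub>0\<^sub>,\<^sub>i\<close> is
\<open>(q; q)\<^sub>\<infinity> G\<^sub>k\<^sub>+\<^sub>1\<^sub>-\<^sub>i\<close> by the Jacobi triple product identity. Everything is done modulo \<open>q^N\<close> for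
arbitrary \<open>N\<close>, with finite sums and products, so that no limits are needed.
\<close>

subsection \<open>Congruence modulo a power of the variable\<close>

definition fps_cong :: "nat \<Rightarrow> 'a::comm_ring_1 fps \<Rightarrow> 'a fps \<Rightarrow> bool" where
  "fps_cong N f g \<longleftrightarrow> (\<forall>m<N. fps_nth f m = fps_nth g m)"

lemma fps_cong_refl [simp]: "fps_cong N f f"
  by (simp add: fps_cong_def)

lemma fps_cong_sym: "fps_cong N f g \<Longrightarrow> fps_cong N g f"
  by (simp add: fps_cong_def)

lemma fps_cong_trans [trans]: "fps_cong N f g \<Longrightarrow> fps_cong N g h \<Longrightarrow> fps_cong N f h"
  by (simp add: fps_cong_def)

lemma fps_cong_mono: "fps_cong N f g \<Longrightarrow> M \<le> N \<Longrightarrow> fps_cong M f g"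
  by (simp add: fps_cong_def)

lemma fps_cong_add: "fps_cong N f g \<Longrightarrow> fps_cong N f' g' \<Longrightarrow> fps_cong N (f + f') (g + g')"
  by (simp add: fps_cong_def)

lemma fps_cong_diff: "fps_cong N f g \<Longrightarrow> fps_cong N f' g' \<Longrightarrow> fps_cong N (f - f') (g - g')"
  by (simp add: fps_cong_def)

lemma fps_cong_mult:
  assumes "fps_cong N f g" "fps_cong N f' g'"
  shows "fps_cong N (f * f') (g * g')"
  using assms by (auto simp: fps_cong_def fps_mult_nth intro!: sum.cong)

lemma fps_cong_mult_left: "fps_cong N f g \<Longrightarrow> fps_cong N (h * f) (h * g)"
  by (rule fps_cong_mult) simp_all

lemma fps_cong_sum:
  "(\<And>x. x \<in> A \<Longrightarrow> fps_cong N (f x) (g x)) \<Longrightarrow> fps_cong N (sum f A) (sum g A)"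
  by (simp add: fps_cong_def fps_sum_nth)

text \<open>The power gains r orders of precision, which offsets the lower accuracy of off-centre
  q-binomials in the triple product.\<close>

lemma fps_cong_X_power_mult:
  "fps_cong N f g \<Longrightarrow> M \<le> r + N \<Longrightarrow> fps_cong M (fps_X ^ r * f) (fps_X ^ r * g)"
  by (auto simp: fps_cong_def fps_X_power_mult_nth)

lemma fps_cong_X_power_mult_0: "M \<le> r \<Longrightarrow> fps_cong M (fps_X ^ r * f) 0"
  by (auto simp: fps_cong_def fps_X_power_mult_nth)

lemma fps_cong_cancel:
  fixes f g h :: "'a::field fps"
  assumes "fps_cong N (h * f) (h * g)" "fps_nth h 0 \<noteq> 0"
  shows "fps_cong N f g"
proof -
  have "fps_cong N (inverse h * (h * f)) (inverse h * (h * g))"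
    by (rule fps_cong_mult_left[OF assms(1)])
  then show ?thesis
    by (simp add: mult.assoc[symmetric] inverse_mult_eq_1[OF assms(2)])
qed

lemma fps_eqI_cong: "(\<And>N. fps_cong N f g) \<Longrightarrow> f = g"
  by (rule fps_ext) (auto simp: fps_cong_def)

subsection \<open>Finite q-binomial identities\<close>

text \<open>Usually written (Q^(n+1); Q)_j. For Q = q and x = q^j it is what (q; q)_\<infinity>
  leaves of the denominator (q; q)_n (x q^(n+1); q)_\<infinity> in Andrews' function.\<close>

definition qpoch :: "'a::comm_ring_1 \<Rightarrow> nat \<Rightarrow> nat \<Rightarrow> 'a" where
  "qpoch Q j n = (\<Prod>r=1..j. 1 - Q ^ (n + r))"

lemma qpoch_0 [simp]: "qpoch Q 0 n = 1"
  by (simp add: qpoch_def)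

lemma qpoch_Suc: "qpoch Q (Suc j) n = qpoch Q j n * (1 - Q ^ (n + j + 1))"
  by (simp add: qpoch_def)

lemma qpoch_Suc_left: "qpoch Q (Suc j) n = (1 - Q ^ (n + 1)) * qpoch Q j (Suc n)"
  by (induction j) (simp_all add: qpoch_Suc mult_ac)

text \<open>The additional factors 1 - q^(M r) with r > a are 1 to this order.\<close>

lemma fps_cong_qpoch:
  assumes "M > 0" "a \<le> b"
  shows "fps_cong (a + 1) (qpoch (fps_X ^ M) b 0) (qpoch (fps_X ^ M) a 0 :: 'a::comm_ring_1 fps)"
  using assms(2)
proof (induction b rule: dec_induct)
  case (step b)
  have "fps_cong (a + 1) (fps_X ^ (M * (b + 1)) * qpoch (fps_X ^ M) b 0) (0 :: 'a fps)"
    using mult_le_mono[of 1 M "a + 1" "b + 1"] step.hyps assms(1)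
    by (intro fps_cong_X_power_mult_0) simp
  then have "fps_cong (a + 1)
      (qpoch (fps_X ^ M) b 0 - fps_X ^ (M * (b + 1)) * qpoch (fps_X ^ M) b 0)
      (qpoch (fps_X ^ M) a 0 - (0 :: 'a fps))"
    by (rule fps_cong_diff[OF step.IH])
  then show ?case
    by (simp add: qpoch_Suc algebra_simps power_add flip: power_mult)
qed simp

lemma fps_nth_qpoch_0:
  assumes "M > 0"
  shows "fps_nth (qpoch (fps_X ^ M) b 0 :: 'a::comm_ring_1 fps) 0 = 1"
  using fps_cong_qpoch[OF assms, of 0 b] by (simp add: fps_cong_def)

text \<open>Gaussian binomial coefficients, by a Pascal rule because quotients of
  \<open>qpoch\<close> need not exist in a commutative ring.\<close>

fun qbinom :: "'a::comm_ring_1 \<Rightarrow> nat \<Rightarrow> nat \<Rightarrow> 'a" where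
  "qbinom Q n 0 = 1"
| "qbinom Q 0 (Suc r) = 0"
| "qbinom Q (Suc n) (Suc r) = Q ^ Suc r * qbinom Q n (Suc r) + qbinom Q n r"

lemma qbinom_eq_0: "n < r \<Longrightarrow> qbinom Q n r = 0"
  by (induction Q n r rule: qbinom.induct) auto

lemma qbinom_self: "qbinom Q n n = 1"
  by (induction n) (simp_all add: qbinom_eq_0)

lemma Suc_choose_2: "Suc n choose 2 = (n choose 2) + n"
  by (simp add: numeral_2_eq_2)

text \<open>Splitting off the factor m = 0 replaces x by \<open>x * Q\<close> in the rest; comparing
  coefficients is then the Pascal rule of \<open>qbinom\<close>.\<close>

theorem q_binomial_theorem:
  fixes x y Q :: "'a::comm_ring_1"
  shows "(\<Prod>m<N. y + x * Q ^ m) =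
    (\<Sum>r\<le>N. qbinom Q N r * Q ^ (r choose 2) * x ^ r * y ^ (N - r))"
proof (induction N arbitrary: x)
  case (Suc N)
  let ?t = "\<lambda>N r. qbinom Q N r * Q ^ (r choose 2) * x ^ r * y ^ (N - r)"
  let ?u = "\<lambda>r. qbinom Q N r * Q ^ (r choose 2) * (x * Q) ^ r * y ^ (N - r)"
  have "(\<Prod>m<Suc N. y + x * Q ^ m) = (y + x) * (\<Prod>m<N. y + (x * Q) * Q ^ m)"
    by (subst prod.lessThan_Suc_shift) (simp add: mult_ac)
  also have "\<dots> = (y + x) * (\<Sum>r\<le>N. ?u r)"
    by (simp only: Suc.IH)
  also have "\<dots> = (\<Sum>r\<le>N. y * ?u r) + (\<Sum>r\<le>N. x * ?u r)"
    by (simp only: distrib_right sum_distrib_left sum.distrib)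
  also have "(\<Sum>r\<le>N. y * ?u r) = (\<Sum>r\<le>Suc N. y * ?u r)"
    by (simp add: qbinom_eq_0)
  also have "\<dots> = y * ?u 0 + (\<Sum>r\<le>N. y * ?u (Suc r))"
    by (rule sum.atMost_Suc_shift)
  also have "y * ?u 0 + (\<Sum>r\<le>N. y * ?u (Suc r)) + (\<Sum>r\<le>N. x * ?u r)
      = ?t (Suc N) 0 + (\<Sum>r\<le>N. y * ?u (Suc r) + x * ?u r)"
    by (simp add: sum.distrib)
  also have "(\<Sum>r\<le>N. y * ?u (Suc r) + x * ?u r) = (\<Sum>r\<le>N. ?t (Suc N) (Suc r))"
  proof (rule sum.cong[OF refl])
    fix r assume "r \<in> {..N}"
    then consider "r = N" | d where "N = r + Suc d"
      by (metis atMost_iff le_neq_implies_less less_imp_Suc_add add_Suc_right)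
    then show "y * ?u (Suc r) + x * ?u r = ?t (Suc N) (Suc r)"
      by cases (simp_all add: qbinom_eq_0 Suc_choose_2 power_add power_mult_distrib algebra_simps)
  qed
  also have "?t (Suc N) 0 + (\<Sum>r\<le>N. ?t (Suc N) (Suc r)) = (\<Sum>r\<le>Suc N. ?t (Suc N) r)"
    by (rule sum.atMost_Suc_shift[symmetric])
  finally show ?case .
qed (simp add: binomial_eq_0)

text \<open>The product formula without division. The two Pascal terms combine by 1 - Q^(a+b) = Q^a
  (1 - Q^b) + (1 - Q^a).\<close>

lemma qbinom_qpoch: "qbinom Q (a + b) a * qpoch Q a 0 * qpoch Q b 0 = qpoch Q (a + b) 0"
proof (induction "a + b" arbitrary: a b)
  case (Suc n)
  show ?case
  proof (cases "a = 0 \<or> b = 0")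
    case True
    then show ?thesis by (auto simp: qbinom_self)
  next
    case False
    then obtain a' b' where ab: "a = Suc a'" "b = Suc b'"
      by (metis not0_implies_Suc)
    have n: "a' + b = n" "a + b' = n" "a' + Suc b' = n" "Suc (a' + b') = n" using Suc.hyps(2) ab by auto
    have IH1: "qbinom Q n a' * qpoch Q a' 0 * qpoch Q b 0 = qpoch Q n 0"
      and IH2: "qbinom Q n a * qpoch Q a 0 * qpoch Q b' 0 = qpoch Q n 0"
      using Suc.hyps(1)[of a' b] Suc.hyps(1)[of a b'] n by auto
    have "qbinom Q (a + b) a * qpoch Q a 0 * qpoch Q b 0
        = Q ^ a * (1 - Q ^ b) * (qbinom Q n a * qpoch Q a 0 * qpoch Q b' 0)
          + (1 - Q ^ a) * (qbinom Q n a' * qpoch Q a' 0 * qpoch Q b 0)"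
      using n by (simp add: ab qpoch_Suc algebra_simps)
    also have "\<dots> = (1 - Q ^ (a + b)) * qpoch Q n 0"
      unfolding IH1 IH2 by (simp add: algebra_simps power_add)
    also have "\<dots> = qpoch Q (a + b) 0"
      using n by (simp add: ab qpoch_Suc mult_ac)
    finally show ?thesis .
  qed
qed simp

text \<open>In the product formula all \<open>qpoch\<close> factors have length at least
  \<open>min a b\<close>, hence agree to this order.\<close>

lemma fps_cong_qbinom:
  fixes a b L M :: nat
  assumes "M > 0" "L \<ge> min a b"
  shows "fps_cong (min a b + 1) (qpoch (fps_X ^ M) L 0 * qbinom (fps_X ^ M) (a + b) a) (1 :: 'a::field fps)"
proof -
  let ?P = "\<lambda>n. qpoch (fps_X ^ M) n 0 :: 'a fps" and ?c = "min a b"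
  let ?B = "qbinom (fps_X ^ M) (a + b) a :: 'a fps"
  have P: "fps_cong (?c + 1) (?P n) (?P n')" if "?c \<le> n" "?c \<le> n'" for n n'
    using that fps_cong_qpoch[OF assms(1)] fps_cong_sym fps_cong_trans by meson
  \<comment> \<open>A second \<open>?P L\<close> makes room for both \<open>?P a\<close> and
    \<open>?P b\<close>; one copy is cancelled at the end, its constant term being 1.\<close>
  have "fps_cong (?c + 1) (?P L * (?P L * ?B)) (?P a * (?P b * ?B))"
    by (intro fps_cong_mult fps_cong_refl P) (use assms(2) in auto)
  also have "?P a * (?P b * ?B) = ?P (a + b)"
    using qbinom_qpoch[of "fps_X ^ M :: 'a fps" a b] by (simp add: mult_ac)
  also have "fps_cong (?c + 1) (?P (a + b)) (?P L * 1)"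
    unfolding mult_1_right by (rule P) (use assms(2) in auto)
  finally show ?thesis
    by (rule fps_cong_cancel) (simp add: fps_nth_qpoch_0[OF assms(1)])
qed

subsection \<open>Andrews' series\<close>

text \<open>
The factor \<open>q^(-in)\<close> of Andrews' series is absorbed into \<open>(2k + 1) n(n + 1)/2 = (2k + 1)(n choose 2) + (2k + 1) n\<close>
to keep the exponent natural; the subtraction is exact for \<open>i \<le> 2k + 1\<close>.
\<close>
definition andrews_term :: "nat \<Rightarrow> nat \<Rightarrow> nat \<Rightarrow> nat \<Rightarrow> 'a::comm_ring_1 fps" where
  "andrews_term k j i n = (-1) ^ n *
     fps_X ^ (k * j * n + (2 * k + 1) * (n choose 2) + (2 * k + 1 - i) * n) *
     (1 - fps_X ^ ((2 * n + 1 + j) * i)) * qpoch fps_X j n"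

definition andrews_sum :: "nat \<Rightarrow> nat \<Rightarrow> nat \<Rightarrow> nat \<Rightarrow> 'a::comm_ring_1 fps" where
  "andrews_sum k N j i = (\<Sum>n<N. andrews_term k j i n)"

lemma andrews_sum_0 [simp]: "andrews_sum k N j 0 = 0"
  by (simp add: andrews_sum_def andrews_term_def)

text \<open>Andrews' functional equation. Each difference of terms splits as
  \<open>A n + B n\<close>, while \<open>A (Suc n) + B n\<close> is a term of the next row; after
  shifting the \<open>A\<close> part only \<open>A N\<close> is left over, of order at least
  N.\<close>

lemma andrews_sum_rec:
  assumes "i < k"
  shows "fps_cong N (andrews_sum k N j (Suc i) :: 'a::comm_ring_1 fps)
    (andrews_sum k N j i + fps_X ^ ((j + 1) * i) * andrews_sum k N (j + 1) (k - i))"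
proof -
  obtain d where k: "k = i + Suc d"
    using assms less_imp_Suc_add by auto
  let ?e = "\<lambda>n. k * j * n + (2 * k + 1) * (n choose 2) + (2 * d + i + 2) * n"
  define A :: "nat \<Rightarrow> 'a fps" where
    "A n = (-1) ^ n * fps_X ^ ?e n * (1 - fps_X ^ n) * qpoch fps_X j n" for n
  define B :: "nat \<Rightarrow> 'a fps" where
    "B n = (-1) ^ n * fps_X ^ (?e n + n + (2 * n + 1 + j) * i) * (1 - fps_X ^ (n + j + 1)) * qpoch fps_X j n"
    for n
  have AB: "andrews_term k j (Suc i) n - andrews_term k j i n = A n + B n" for n
  proof -
    have e: "2 * k + 1 - Suc i = 2 * d + i + 2" "2 * k + 1 - i = Suc (2 * d + i + 2)"
      by (simp_all add: k)
    \<comment> \<open>The splitting is 1 - b z y - z (1 - b) = (1 - z) + z b (1 - y) with z = q^n, y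
      = q^(n+j+1), b = q^((2n+1+j)i).\<close>
    have *: "u * x * (1 - b * (xx * y)) * c - u * (x * xn) * (1 - b) * c =
        u * x * (1 - xn) * c + u * (x * xn * b) * (1 - y') * c" 
      if "xx * y = xn * y'" for u x xx y b c xn y' :: "'a fps"
    proof -
      have "b * (xx * y) = b * (xn * y')" using that by simp
      then show ?thesis by (simp add: algebra_simps)
    qed
    have 1: "fps_X ^ ((2 * n + 1 + j) * Suc i) =
        fps_X ^ ((2 * n + 1 + j) * i) * (fps_X ^ n * fps_X ^ (n + j + 1) :: 'a fps)"
      unfolding power_add[symmetric] by (rule arg_cong[where f = "power fps_X"]) (simp add: algebra_simps)
    have 2: "fps_X ^ (k * j * n + (2 * k + 1) * (n choose 2) + Suc (2 * d + i + 2) * n) =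
        fps_X ^ ?e n * (fps_X ^ n :: 'a fps)"
      unfolding power_add[symmetric] by (rule arg_cong[where f = "power fps_X"]) (simp add: algebra_simps)
    show ?thesis
      unfolding andrews_term_def A_def B_def e 1 2 power_add[of _ "?e n + n"] power_add[of _ "?e n" n]
      by (rule *) simp
  qed
  \<comment> \<open>The factor 1 - q^(n+1) of \<open>A (Suc n)\<close> extends its
    \<open>qpoch\<close> on the left, the factor 1 - q^(n+j+1) of \<open>B n\<close> on the right;
    both become \<open>qpoch fps_X (j + 1) n\<close>.\<close>
  have shift: "A (Suc n) + B n = fps_X ^ ((j + 1) * i) * andrews_term k (j + 1) (k - i) n" for n
  proof -
    have e: "2 * k + 1 - (k - i) = 2 * i + d + 2" "k - i = Suc d"
      by (simp_all add: k)
    let ?f = "(j + 1) * i + (k * (j + 1) * n + (2 * k + 1) * (n choose 2) + (2 * i + d + 2) * n)"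
    have 1: "?e (Suc n) = ?f + (2 * n + 1 + (j + 1)) * Suc d"
      by (simp add: k Suc_choose_2 algebra_simps)
    have 2: "?e n + n + (2 * n + 1 + j) * i = ?f"
      by (simp add: k algebra_simps)
    have "A (Suc n) = - ((-1) ^ n * fps_X ^ ?f * fps_X ^ ((2 * n + 1 + (j + 1)) * Suc d) * qpoch fps_X (j + 1) n)"
      unfolding A_def 1 power_add[of _ ?f] by (simp add: qpoch_Suc_left mult_ac)
    moreover have "B n = (-1) ^ n * fps_X ^ ?f * qpoch fps_X (j + 1) n"
      unfolding B_def 2 by (simp add: qpoch_Suc mult_ac)
    ultimately show ?thesis
      unfolding andrews_term_def e(1) unfolding e(2) power_add[of _ "(j + 1) * i"] by (simp add: algebra_simps)
  qed
  have "andrews_sum k N j (Suc i) - andrews_sum k N j i = (\<Sum>n<N. A n + B n)"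
    by (simp add: andrews_sum_def AB flip: sum_subtractf)
  also have "\<dots> = (\<Sum>n<N. A (Suc n) + B n) - A N"
  proof -
    \<comment> \<open>The factor 1 - q^0 kills \<open>A 0\<close>, so the shift loses nothing at the
      lower end.\<close>
    have "A 0 = 0" by (simp add: A_def)
    then have "sum A {..<N} + A N = (\<Sum>n<N. A (Suc n))"
      using sum.lessThan_Suc_shift[of A N] by simp
    then show ?thesis by (simp add: sum.distrib algebra_simps)
  qed
  also have "(\<Sum>n<N. A (Suc n) + B n) = fps_X ^ ((j + 1) * i) * andrews_sum k N (j + 1) (k - i)"
    by (simp only: shift andrews_sum_def sum_distrib_left)
  finally have "andrews_sum k N j (Suc i) =
      andrews_sum k N j i + fps_X ^ ((j + 1) * i) * andrews_sum k N (j + 1) (k - i) - A N"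
    by (simp add: algebra_simps)
  moreover have "fps_cong N (A N) 0"
  proof -
    have "A N = fps_X ^ ?e N * ((-1) ^ N * (1 - fps_X ^ N) * qpoch fps_X j N)"
      by (simp add: A_def mult_ac)
    moreover have "N \<le> ?e N"
      by (rule trans_le_add2) simp
    ultimately show ?thesis
      by (simp only: fps_cong_X_power_mult_0)
  qed
  ultimately show ?thesis
    using fps_cong_diff[OF fps_cong_refl, of N "A N" 0] by (metis diff_0_right)
qed

text \<open>Only n = 0 survives: for n \<ge> 1 the exponent is at least k j + (2k + 1 - i) \<ge> j +
  1. The term n = 0 is (1 - q^((j+1)i)) (q; q)_j, whose first factor is 1 to this order as i \<ge>
  1.\<close>

lemma andrews_sum_cong:
  assumes "1 \<le> i" "i \<le> k"
  shows "fps_cong (min N (j + 1)) (andrews_sum k N j i :: 'a::comm_ring_1 fps) (qpoch fps_X N 0)"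
proof (cases N)
  case (Suc N')
  let ?M = "min N (j + 1)"
  have "fps_cong ?M (andrews_term k j i (Suc n) :: 'a fps) 0" for n
  proof -
    let ?e = "k * j * Suc n + (2 * k + 1) * (Suc n choose 2) + (2 * k + 1 - i) * Suc n"
    have "1 * j * 1 \<le> k * j * Suc n"
      by (intro mult_le_mono) (use assms in auto)
    moreover have "1 * 1 \<le> (2 * k + 1 - i) * Suc n"
      by (intro mult_le_mono) (use assms in auto)
    ultimately have "?M \<le> ?e" by linarith
    then have "fps_cong ?M (fps_X ^ ?e * ((-1) ^ Suc n * (1 - fps_X ^ ((2 * Suc n + 1 + j) * i)) *
        qpoch fps_X j (Suc n)) :: 'a fps) 0"
      by (rule fps_cong_X_power_mult_0)
    then show ?thesis
      unfolding andrews_term_def by (simp only: mult_ac)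
  qed
  then have "fps_cong ?M (\<Sum>n<N'. andrews_term k j i (Suc n) :: 'a fps) (\<Sum>n<N'. 0)"
    by (rule fps_cong_sum)
  moreover have "fps_cong ?M (andrews_term k j i 0 :: 'a fps) (qpoch fps_X j 0)"
  proof -
    have "j + 1 \<le> (1 + j) * i" using mult_le_mono2[of 1 i "1 + j"] assms by simp
    then have "fps_cong ?M (fps_X ^ ((1 + j) * i) * qpoch fps_X j 0 :: 'a fps) 0"
      by (intro fps_cong_X_power_mult_0) simp
    from fps_cong_diff[OF fps_cong_refl this, of "qpoch fps_X j 0"]
    show ?thesis by (simp add: andrews_term_def binomial_eq_0 algebra_simps)
  qed
  ultimately have "fps_cong ?M (andrews_sum k N j i :: 'a fps) (qpoch fps_X j 0)"
    unfolding andrews_sum_def Suc sum.lessThan_Suc_shift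
    using fps_cong_add by fastforce
  also have "fps_cong ?M (qpoch fps_X j 0 :: 'a fps) (qpoch fps_X N 0)"
  proof (cases "j \<le> N")
    case True
    from fps_cong_qpoch[of 1 j N, where 'a = 'a] this show ?thesis
      by (auto intro: fps_cong_sym fps_cong_mono)
  next
    case False
    with fps_cong_qpoch[of 1 N j, where 'a = 'a] show ?thesis
      by (auto intro: fps_cong_mono)
  qed
  finally show ?thesis .
qed (simp add: fps_cong_def)

text \<open>Modulo \<open>X ^ N\<close>, the recursion transports vanishing from the rows \<open>j \<ge> N\<close> down to all rows.\<close>
lemma recursion_solution_unique:
  fixes D :: "nat \<Rightarrow> nat \<Rightarrow> 'a::comm_ring_1 fps"
  assumes D0: "\<And>j. D j 0 = 0"
    and rec: "\<And>j i. i < k \<Longrightarrow> fps_cong N (D j (Suc i)) (D j i + fps_X ^ ((j + 1) * i) * D (j + 1) (k - i))"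
    and small: "\<And>j i. 1 \<le> i \<Longrightarrow> i \<le> k \<Longrightarrow> fps_cong (min N (j + 1)) (D j i) 0"
    and "i \<le> k"
  shows "fps_cong N (D j i) 0"
  using \<open>i \<le> k\<close>
\<comment> \<open>Truncated \<open>N - j\<close> is 0 exactly when j \<ge> N, where
  \<open>small\<close> has full precision N. In the other rows an inner induction on i climbs from
  \<open>D j 0 = 0\<close>.\<close>
proof (induction "N - j" arbitrary: j i)
  case 0
  then show ?case
    using small[of i j] by (cases i) (auto simp: D0 min_def split: if_splits)
next
  case (Suc n)
  note IH = Suc.hyps(1)[of "j + 1"]
  show ?case using Suc.prems
  proof (induction i)
    case (Suc i)
    have "fps_cong N (fps_X ^ ((j + 1) * i) * D (j + 1) (k - i)) (fps_X ^ ((j + 1) * i) * 0)"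
      by (intro fps_cong_mult_left IH) (use \<open>Suc n = N - j\<close> in auto)
    with Suc have "fps_cong N (D j i + fps_X ^ ((j + 1) * i) * D (j + 1) (k - i)) (0 + 0)"
      by (intro fps_cong_add) auto
    with rec[of i j] Suc.prems fps_cong_trans show ?case by force
  qed (simp add: D0)
qed

subsection \<open>The triple product\<close>

lemma prod_lessThan_Suc_eq_qpoch: "(\<Prod>m<n. 1 - Q ^ Suc m) = qpoch Q n 0"
  by (induction n) (simp_all add: qpoch_Suc)

text \<open>
The q-binomial theorem in base \<open>Q = q^M\<close> with \<open>2 L\<close> factors \<open>y + x Q^m\<close>, where \<open>y = Q^L\<close> and \<open>x = -q^i\<close>;
the homogeneous form avoids negative powers.
\<close>
lemma finite_jacobi_triple_product:
  fixes M i L :: nat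
  assumes "i \<le> M"
  shows "(\<Prod>m<L. 1 - fps_X ^ (M * m + i)) * (\<Prod>m<L. 1 - fps_X ^ (M * m + (M - i))) =
    (\<Sum>n\<le>L. (-1) ^ n * fps_X ^ (M * (n choose 2) + (M - i) * n) * qbinom (fps_X ^ M) (2 * L) (L - n)) -
    (\<Sum>n<L. (-1) ^ n * fps_X ^ (M * (Suc n choose 2) + i * Suc n) *
       qbinom (fps_X ^ M) (2 * L) (L + Suc n) :: 'a::idom fps)"
proof -
  let ?X = "fps_X :: 'a fps"
  \<comment> \<open>Exponent of the monomial pulled out of the product: each of the first L factors
    yields -q^(i + M m), each of the last L factors q^(M L).\<close>
  let ?u = "i * L + M * (L * L + (L choose 2))"
  let ?t = "\<lambda>r. qbinom (?X ^ M) (2 * L) r * (?X ^ M) ^ (r choose 2) * (- (?X ^ i)) ^ r * (?X ^ (M * L)) ^ (2 * L - r)"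
  let ?b = "\<lambda>n. (-1) ^ n * ?X ^ (M * (n choose 2) + (M - i) * n) * qbinom (?X ^ M) (2 * L) (L - n)"
  let ?c = "\<lambda>n. (-1) ^ n * ?X ^ (M * (Suc n choose 2) + i * Suc n) * qbinom (?X ^ M) (2 * L) (L + Suc n)"
  let ?K = "(-1) ^ L * ?X ^ ?u"
  obtain i' where M: "M = i + i'" using assms le_Suc_ex by blast
  have choose_add: "((a + b) choose 2) = (a choose 2) + (b choose 2) + a * b" for a b :: nat
    by (induction a) (simp_all add: Suc_choose_2 binomial_eq_0)
  have "(\<Prod>m<2 * L. ?X ^ (M * L) + - (?X ^ i) * (?X ^ M) ^ m) =
      (\<Prod>m<L. ?X ^ (M * L) + - (?X ^ i) * (?X ^ M) ^ m) *
      (\<Prod>m<L. ?X ^ (M * L) + - (?X ^ i) * (?X ^ M) ^ (m + L))"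
    using prod.atLeastLessThan_concat[of 0 L "2 * L" "\<lambda>m. ?X ^ (M * L) + - (?X ^ i) * (?X ^ M) ^ m"]
      prod.shift_bounds_nat_ivl[of "\<lambda>m. ?X ^ (M * L) + - (?X ^ i) * (?X ^ M) ^ m" 0 L L]
    by (simp add: lessThan_atLeast0 mult_2)
  also have "(\<Prod>m<L. ?X ^ (M * L) + - (?X ^ i) * (?X ^ M) ^ m) =
      (\<Prod>m<L. - (?X ^ (i + M * m)) * (1 - ?X ^ (M * (L - Suc m) + (M - i))))"
  proof (rule prod.cong[OF refl])
    fix m assume "m \<in> {..<L}"
    then obtain d where "L = m + Suc d" using less_imp_Suc_add by auto
    then have "M * L = (i + M * m) + (M * (L - Suc m) + (M - i))"
      by (simp add: M algebra_simps)
    then have "?X ^ (M * L) = ?X ^ (i + M * m) * ?X ^ (M * (L - Suc m) + (M - i))"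
      by (simp only: power_add[symmetric])
    then show "?X ^ (M * L) + - (?X ^ i) * (?X ^ M) ^ m =
        - (?X ^ (i + M * m)) * (1 - ?X ^ (M * (L - Suc m) + (M - i)))"
      by (simp only: power_mult[symmetric]) (simp add: algebra_simps power_add)
  qed
  also have "\<dots> = (\<Prod>m<L. - (?X ^ (i + M * m))) * (\<Prod>m<L. 1 - ?X ^ (M * m + (M - i)))"
    using prod.nat_diff_reindex[of "\<lambda>m. 1 - ?X ^ (M * m + (M - i))" L] by (simp only: prod.distrib)
  also have "(\<Prod>m<L. - (?X ^ (i + M * m))) = (-1) ^ L * ?X ^ (i * L + M * (L choose 2))"
    by (induction L) (simp_all add: Suc_choose_2 algebra_simps power_add binomial_eq_0)
  also have "(\<Prod>m<L. ?X ^ (M * L) + - (?X ^ i) * (?X ^ M) ^ (m + L)) =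
      (\<Prod>m<L. ?X ^ (M * L) * (1 - ?X ^ (M * m + i)))"
    by (rule prod.cong) (simp_all add: algebra_simps power_add flip: power_mult)
  also have "\<dots> = ?X ^ (M * L * L) * (\<Prod>m<L. 1 - ?X ^ (M * m + i))"
    by (simp add: prod.distrib power_mult)
  finally have lhs: "(\<Prod>m<2 * L. ?X ^ (M * L) + - (?X ^ i) * (?X ^ M) ^ m) =
      ?K * ((\<Prod>m<L. 1 - ?X ^ (M * m + i)) * (\<Prod>m<L. 1 - ?X ^ (M * m + (M - i))))"
    by (simp add: algebra_simps power_add)
  have t: "?t r = (-1) ^ r * (?X ^ (M * (r choose 2) + i * r + M * L * (2 * L - r)) * qbinom (?X ^ M) (2 * L) r)" for r
  proof -
    have *: "(- (?X ^ i)) ^ r = (-1) ^ r * ?X ^ (i * r)"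
      by (metis power_minus power_mult)
    show ?thesis unfolding * power_add power_mult by (simp only: mult_ac)
  qed
  \<comment> \<open>The q-binomial sum is re-centred at r = L: \<open>neg\<close> treats r = L - n,
    \<open>pos\<close> treats r = L + Suc n.\<close>
  have neg: "?t (L - n) = ?K * ?b n" if n: "n \<le> L" for n
  proof -
    obtain d where L: "L = n + d" using n le_Suc_ex by blast
    have e: "M * ((L - n) choose 2) + i * (L - n) + M * L * (2 * L - (L - n)) =
        ?u + (M * (n choose 2) + (M - i) * n)"
    proof -
      have "(M - i) * n + i * n = M * n"
        by (simp add: M algebra_simps)
      moreover have "n * n = 2 * (n choose 2) + n"
        by (induction n) (simp_all add: Suc_choose_2 binomial_eq_0)
      then have "M * (n * n) = M * (2 * (n choose 2) + n)" by simp
      ultimately show ?thesis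
        by (simp add: L choose_add algebra_simps)
    qed
    have "?t (L - n) = (-1) ^ (L - n) *
        (?X ^ (?u + (M * (n choose 2) + (M - i) * n)) * qbinom (?X ^ M) (2 * L) (L - n))"
      by (subst t, subst e) (rule refl)
    also have "(-1) ^ (L - n) = ((-1) ^ L * (-1) ^ n :: 'a fps)"
      by (simp add: L power_add)
    finally show ?thesis
      unfolding power_add[of _ ?u] by (simp only: mult_ac)
  qed
  have pos: "?t (L + Suc n) = - (?K * ?c n)" if n: "n < L" for n
  proof -
    obtain d where L: "L = n + Suc d" using n less_imp_Suc_add by auto
    have e: "M * ((L + Suc n) choose 2) + i * (L + Suc n) + M * L * (2 * L - (L + Suc n)) =
        ?u + (M * (Suc n choose 2) + i * Suc n)"
    proof -
      have "2 * L - (L + Suc n) = d" "L * L = L * Suc n + L * d"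
        by (simp_all add: L algebra_simps)
      then show ?thesis
        by (simp only: choose_add) (simp add: algebra_simps)
    qed
    have "?t (L + Suc n) = (-1) ^ (L + Suc n) *
        (?X ^ (?u + (M * (Suc n choose 2) + i * Suc n)) * qbinom (?X ^ M) (2 * L) (L + Suc n))"
      by (subst t, subst e) (rule refl)
    also have "(-1) ^ (L + Suc n) = - ((-1) ^ L * (-1) ^ n :: 'a fps)"
      by (simp add: power_add)
    finally show ?thesis
      unfolding power_add[of _ ?u] by (simp only: mult_ac mult_minus_left)
  qed
  have split: "(\<Sum>r\<le>2 * L. f r) = (\<Sum>r\<le>L. f r) + (\<Sum>n<L. f (L + Suc n))" for f :: "nat \<Rightarrow> 'a fps"
    using sum.atLeastLessThan_concat[of 0 "Suc L" "Suc (2 * L)" f]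
      sum.shift_bounds_nat_ivl[of f 0 "Suc L" L]
    by (simp add: lessThan_Suc_atMost[symmetric] lessThan_atLeast0 mult_2 add.commute
        del: sum.op_ivl_Suc sum.lessThan_Suc)
  have "(\<Sum>r\<le>2 * L. ?t r) = (\<Sum>r\<le>L. ?t r) + (\<Sum>n<L. ?t (L + Suc n))"
    by (rule split)
  also have "(\<Sum>r\<le>L. ?t r) = (\<Sum>n\<le>L. ?t (L - n))"
    by (rule sum.reindex_bij_witness[of _ "\<lambda>n. L - n" "\<lambda>n. L - n"]) auto
  also have "(\<Sum>n\<le>L. ?t (L - n)) = ?K * (\<Sum>n\<le>L. ?b n)"
    unfolding sum_distrib_left by (rule sum.cong[OF refl], rule neg) simp
  also have "(\<Sum>n<L. ?t (L + Suc n)) = - (?K * (\<Sum>n<L. ?c n))"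
    unfolding sum_distrib_left sum_negf[symmetric] by (rule sum.cong[OF refl], rule pos) simp
  also have "?K * (\<Sum>n\<le>L. ?b n) + - (?K * (\<Sum>n<L. ?c n)) = ?K * ((\<Sum>n\<le>L. ?b n) - (\<Sum>n<L. ?c n))"
    by (simp only: right_diff_distrib diff_conv_add_uminus[symmetric])
  finally have "?K * ((\<Prod>m<L. 1 - ?X ^ (M * m + i)) * (\<Prod>m<L. 1 - ?X ^ (M * m + (M - i)))) =
      ?K * ((\<Sum>n\<le>L. ?b n) - (\<Sum>n<L. ?c n))"
    by (simp only: lhs[symmetric] q_binomial_theorem)
  then show ?thesis by simp
qed

text \<open>Multiplied by \<open>?P\<close>, the q-binomial at distance n from the centre is 1
  modulo q^(L-n+1), and its power of q has exponent at least n; together this gives precision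
  L.\<close>

lemma andrews_sum_triple_product:
  fixes L k i :: nat
  defines "M \<equiv> 2 * k + 1"
  assumes "1 \<le> i" "i \<le> k"
  shows "fps_cong L (andrews_sum k L 0 i)
    (qpoch (fps_X ^ M) L 0 * (\<Prod>m<L. 1 - fps_X ^ (M * m + i)) *
      (\<Prod>m<L. 1 - fps_X ^ (M * m + (M - i))) :: 'a::field fps)"
proof -
  let ?P = "qpoch (fps_X ^ M) L 0 :: 'a fps"
  let ?q = "qbinom (fps_X ^ M) (2 * L) :: nat \<Rightarrow> 'a fps"
  let ?e = "\<lambda>n. M * (n choose 2) + (M - i) * n"
  let ?f = "\<lambda>n. M * (Suc n choose 2) + i * Suc n"
  have cong: "fps_cong L (fps_X ^ e * (?P * ?q r)) (fps_X ^ e * 1)"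
    if "n \<le> e" "n \<le> L" "r = L - n \<or> r = L + n" for e n r
  proof (rule fps_cong_X_power_mult)
    have "min r (2 * L - r) = L - n" "2 * L = r + (2 * L - r)"
      using that by auto
    moreover have "fps_cong (min r (2 * L - r) + 1) (?P * qbinom (fps_X ^ M) (r + (2 * L - r)) r) 1"
      by (rule fps_cong_qbinom) (auto simp: M_def)
    ultimately show "fps_cong (L - n + 1) (?P * ?q r) 1"
      by (simp only: flip: \<open>2 * L = r + (2 * L - r)\<close>)
  qed (use that in simp)
  have e: "n \<le> ?e n" and f: "Suc n \<le> ?f n" for n
  proof -
    have "1 * n \<le> (M - i) * n" "1 * Suc n \<le> i * Suc n"
      by (rule mult_le_mono1, use assms in linarith)+
    then show "n \<le> ?e n" "Suc n \<le> ?f n"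
      by (simp_all only: mult_1 trans_le_add2)
  qed
  have iM: "i \<le> M" using assms(2,3) by (simp add: M_def)
  have jtp: "?P * (\<Prod>m<L. 1 - fps_X ^ (M * m + i)) * (\<Prod>m<L. 1 - fps_X ^ (M * m + (M - i))) =
      (\<Sum>n\<le>L. (-1) ^ n * (fps_X ^ ?e n * (?P * ?q (L - n)))) -
      (\<Sum>n<L. (-1) ^ n * (fps_X ^ ?f n * (?P * ?q (L + Suc n))))"
    unfolding mult.assoc finite_jacobi_triple_product[OF iM] right_diff_distrib sum_distrib_left
    by (simp only: mult_ac)
  have "fps_cong L
      ((\<Sum>n\<le>L. (-1) ^ n * (fps_X ^ ?e n * (?P * ?q (L - n)))) -
        (\<Sum>n<L. (-1) ^ n * (fps_X ^ ?f n * (?P * ?q (L + Suc n)))))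
      ((\<Sum>n\<le>L. (-1) ^ n * (fps_X ^ ?e n * 1)) -
      (\<Sum>n<L. (-1) ^ n * (fps_X ^ ?f n * 1)))"
  proof (intro fps_cong_diff fps_cong_sum)
    show "fps_cong L ((-1) ^ n * (fps_X ^ ?e n * (?P * ?q (L - n)))) ((-1) ^ n * (fps_X ^ ?e n * 1))"
      if "n \<in> {..L}" for n
      by (rule fps_cong_mult_left, rule cong[OF e]) (use that in simp_all)
    show "fps_cong L ((-1) ^ n * (fps_X ^ ?f n * (?P * ?q (L + Suc n)))) ((-1) ^ n * (fps_X ^ ?f n * 1))"
      if "n \<in> {..<L}" for n
      by (rule fps_cong_mult_left, rule cong[OF f]) (use that in simp_all)
  qed
  \<comment> \<open>The first sum has one more term, n = L, of order at least L.\<close>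
  also have "fps_cong L \<dots> (((\<Sum>n<L. (-1) ^ n * fps_X ^ ?e n) + 0) -
      (\<Sum>n<L. (-1) ^ n * fps_X ^ ?f n))"
    using fps_cong_X_power_mult_0[OF e[of L], of "(-1) ^ L :: 'a fps"]
    unfolding lessThan_Suc_atMost[symmetric] sum.lessThan_Suc mult_1_right
    by (intro fps_cong_diff fps_cong_add fps_cong_refl) (simp add: mult.commute)
  also have "((\<Sum>n<L. (-1) ^ n * fps_X ^ ?e n) + 0) - (\<Sum>n<L. (-1) ^ n * fps_X ^ ?f n) = (andrews_sum k L 0 i :: 'a fps)"
  proof -
    obtain d where d: "M = i + d" using assms le_Suc_ex[of i M] by (auto simp: M_def)
    \<comment> \<open>Pairing the two sums at n thus produces the factor 1 - q^((2n+1)i) of the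
      Andrews term with j = 0.\<close>
    have "?f n = ?e n + (2 * n + 1) * i" for n
      by (simp add: d Suc_choose_2 algebra_simps)
    then have "(-1) ^ n * fps_X ^ ?e n - (-1) ^ n * fps_X ^ ?f n = (andrews_term k 0 i n :: 'a fps)" for n
      by (simp only: andrews_term_def power_add) (simp add: M_def right_diff_distrib mult.assoc)
    then show ?thesis
      by (simp only: andrews_sum_def sum_subtractf[symmetric] add_0_right)
  qed
  finally show ?thesis unfolding jtp by (rule fps_cong_sym)
qed

section \<open>Gordon's product and residues modulo 2k + 1\<close>

text \<open>Coefficients of the partial products are eventually those of the limit, and every factor
  beyond the first N is 1 modulo q^N.\<close>

lemma fps_cong_gordon_product:
  assumes "N \<le> n"
  shows "fps_cong N (gordon_product k l) (\<Prod>r<n. gordon_factor k l (Suc r))"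
proof -
  let ?f = "\<lambda>r. gordon_factor k l (Suc r)"
  \<comment> \<open>Without zero factors, \<open>has_prod\<close> means convergence of the plain
    partial products.\<close>
  have "?f r \<noteq> 0" for r
    using gordon_factor_nth[of 0 "Suc r" k l] by auto
  then have "(\<lambda>n. \<Prod>r\<le>n. ?f r) \<longlonglongrightarrow> gordon_product k l"
    using gordon_product_has_prod[of k l] by (auto simp: has_prod_def raw_has_prod_def)
  then have "(\<lambda>n. \<Prod>r<n. ?f r) \<longlonglongrightarrow> gordon_product k l"
    by (subst (asm) lessThan_Suc_atMost[symmetric]) (rule LIMSEQ_imp_Suc)
  then have ev: "\<forall>\<^sub>F n in sequentially. fps_nth (\<Prod>r<n. ?f r) m = fps_nth (gordon_product k l) m" for m
    by (simp add: tendsto_fps_iff)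
  have const: "fps_cong N (\<Prod>r<n'. ?f r) (\<Prod>r<n. ?f r)" if "n \<le> n'" for n'
    using that
  proof (induction n' rule: dec_induct)
    case (step n')
    have "fps_cong N ((\<Prod>r<n'. ?f r) * ?f n') ((\<Prod>r<n. ?f r) * 1)"
      using step assms by (intro fps_cong_mult) (auto simp: fps_cong_def gordon_factor_nth)
    then show ?case by simp
  qed simp
  show ?thesis unfolding fps_cong_def
  proof (intro allI impI)
    fix m assume m: "m < N"
    obtain n' where "n \<le> n'" "fps_nth (\<Prod>r<n'. ?f r) m = fps_nth (gordon_product k l) m"
      using ev[of m] unfolding eventually_sequentially by (metis nle_le)
    then show "fps_nth (gordon_product k l) m = fps_nth (\<Prod>r<n. ?f r) m"
      using const[of n'] m by (simp add: fps_cong_def)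
  qed
qed

text \<open>The exponents form L blocks of M consecutive numbers. In each block 1 - q^n cancels
  against Gordon's factor unless n is congruent to 0, i or -i; the index k + 1 - i is the one that
  excludes these residues.\<close>

lemma qpoch_mult_gordon_factors:
  fixes k i L :: nat
  defines "M \<equiv> 2 * k + 1"
  assumes "1 \<le> i" "i \<le> k"
  shows "qpoch fps_X (M * L) 0 * (\<Prod>r<M * L. gordon_factor k (k + 1 - i) (Suc r)) =
    qpoch (fps_X ^ M) L 0 * (\<Prod>m<L. 1 - fps_X ^ (M * m + i)) * (\<Prod>m<L. 1 - fps_X ^ (M * m + (M - i)))"
proof -
  let ?g = "\<lambda>r. gordon_factor k (k + 1 - i) (Suc r)"
  define h :: "nat \<Rightarrow> rat fps" where "h r = (1 - fps_X ^ Suc r) * ?g r" for r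
  \<comment> \<open>Positions count from 0 and exponents from 1, so the residues i, -i, 0 appear as
    i - 1, M - i - 1, M - 1.\<close>
  have h: "h (M * m + s) = (if s \<in> {i - 1, M - i - 1, M - 1} then 1 - fps_X ^ Suc (M * m + s) else 1)"
    if "s < M" for m s
  proof -
    have *: "[int (Suc (M * m + s)) = c] (mod (2 * int k + 1)) \<longleftrightarrow> [int (Suc s) = c] (mod int M)" for c
    proof -
      have "int (Suc (M * m + s)) = int M * int m + int (Suc s)"
        by simp
      moreover have "2 * int k + 1 = int M" by (simp add: M_def)
      ultimately show ?thesis by (simp only: cong_def mod_mult_self4)
    qed
    have i: "i < M" "1 \<le> i" using assms by (auto simp: M_def)
    have 1: "[int (Suc s) = 0] (mod int M) \<longleftrightarrow> s = M - 1"
      using dvd_imp_le[of M "Suc s"] that i by (auto simp: cong_0_iff simp del: of_nat_Suc)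
    have 2: "[int (Suc s) = int i] (mod int M) \<longleftrightarrow> s = i - 1"
      using dvd_imp_le_int[of "int (Suc s) - int i" "int M"] that i
      by (cases "int (Suc s) = int i") (auto simp: cong_iff_dvd_diff)
    have 3: "[int (Suc s) = - int i] (mod int M) \<longleftrightarrow> s = M - i - 1"
    proof -
      have "[int (Suc s) = - int i] (mod int M) \<longleftrightarrow> int M dvd (int (Suc s) + int i - int M)"
        using dvd_add_left_iff[of "int M" "- int M" "int (Suc s) + int i"] by (simp add: cong_iff_dvd_diff)
      then show ?thesis
        using dvd_imp_le_int[of "int (Suc s) + int i - int M" "int M"] that i
        by (cases "int (Suc s) + int i = int M") auto
    qed
    have i': "int k + 1 - int (k + 1 - i) = int i" using assms by simp
    have unit: "(1 - fps_X ^ Suc n) * (1 / (1 - fps_X ^ Suc n)) = (1 :: rat fps)" for n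
      by (simp add: fps_divide_unit inverse_mult_eq_1')
    show ?thesis
      unfolding h_def gordon_factor_def i' * 1 2 3 using unit by auto
  qed
  have "qpoch fps_X (M * L) 0 * (\<Prod>r<M * L. ?g r) = (\<Prod>r<L * M. h r)"
    by (simp only: prod_lessThan_Suc_eq_qpoch[symmetric] h_def prod.distrib mult.commute)
  also have "\<dots> = (\<Prod>m<L. prod h {m * M..<m * M + M})"
    by (rule prod.nat_group[symmetric])
  also have "\<dots> = (\<Prod>m<L. (1 - (fps_X ^ M) ^ Suc m) * (1 - fps_X ^ (M * m + i)) * (1 - fps_X ^ (M * m + (M - i))))"
  proof (rule prod.cong[OF refl])
    fix m
    let ?f = "\<lambda>s. 1 - fps_X ^ Suc (M * m + s) :: rat fps"
    have "prod h {m * M..<m * M + M} = (\<Prod>s<M. h (M * m + s))"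
      using prod.shift_bounds_nat_ivl[of h 0 "m * M" M]
      by (simp add: lessThan_atLeast0 add.commute mult.commute)
    also have "\<dots> = (\<Prod>s<M. if s \<in> {i - 1, M - i - 1, M - 1} then ?f s else 1)"
      by (rule prod.cong) (simp_all only: h lessThan_iff)
    also have "\<dots> = prod ?f ({..<M} \<inter> {i - 1, M - i - 1, M - 1})"
      by (subst prod.inter_restrict) simp_all
    also have "{..<M} \<inter> {i - 1, M - i - 1, M - 1} = {i - 1, M - i - 1, M - 1}"
      using assms by auto
    \<comment> \<open>The three positions are distinct because 2i \<le> 2k < M.\<close>
    also have "prod ?f \<dots> = ?f (i - 1) * ?f (M - i - 1) * ?f (M - 1)"
      using assms by (subst prod.insert; (subst prod.insert)?) (auto simp: M_def)
    also have "\<dots> = ?f (M - 1) * ?f (i - 1) * ?f (M - i - 1)"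
      by (simp only: mult_ac)
    finally have "prod h {m * M..<m * M + M} = ?f (M - 1) * ?f (i - 1) * ?f (M - i - 1)" .
    moreover have "Suc (M * m + (M - 1)) = M * Suc m" "Suc (M * m + (i - 1)) = M * m + i"
      "Suc (M * m + (M - i - 1)) = M * m + (M - i)"
      using assms by (auto simp: M_def)
    ultimately show "prod h {m * M..<m * M + M} =
        (1 - (fps_X ^ M) ^ Suc m) * (1 - fps_X ^ (M * m + i)) * (1 - fps_X ^ (M * m + (M - i)))"
      by (simp only: power_mult)
  qed
  finally show ?thesis
    by (simp only: prod.distrib prod_lessThan_Suc_eq_qpoch)
qed

text \<open>Lengthening the products to (2k + 1) N factors changes nothing modulo q^N and completes
  the blocks of residues.\<close>

lemma gordon_product_andrews_sum:
  assumes "1 \<le> i" "i \<le> k"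
  shows "fps_cong N (qpoch fps_X N 0 * gordon_product k (k + 1 - i)) (andrews_sum k N 0 i)"
proof -
  let ?M = "2 * k + 1"
  have N: "N \<le> ?M * N" by simp
  have "fps_cong (N + 1) (qpoch (fps_X ^ 1) (?M * N) 0) (qpoch (fps_X ^ 1) N 0 :: rat fps)"
    by (rule fps_cong_qpoch[OF _ N]) simp
  then have "fps_cong N (qpoch fps_X N 0) (qpoch fps_X (?M * N) 0 :: rat fps)"
    unfolding power_one_right by (rule fps_cong_sym[OF fps_cong_mono]) simp
  then have "fps_cong N (qpoch fps_X N 0 * gordon_product k (k + 1 - i))
      (qpoch fps_X (?M * N) 0 * (\<Prod>r<?M * N. gordon_factor k (k + 1 - i) (Suc r)))"
    by (rule fps_cong_mult[OF _ fps_cong_gordon_product[OF N]])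
  then show ?thesis
    unfolding qpoch_mult_gordon_factors[OF assms]
    by (rule fps_cong_trans) (rule fps_cong_sym[OF andrews_sum_triple_product[OF assms]])
qed

subsection \<open>Removing the smallest parts\<close>

lemma sorted_wrt_ge_replicate:
  assumes "sorted_wrt (\<ge>) ps" "\<forall>p\<in>set ps. p \<ge> (a :: 'a :: linorder)"
  shows "ps = filter (\<lambda>p. p > a) ps @ replicate (count_list ps a) a"
  using assms
proof (induction ps)
  case (Cons p ps)
  show ?case
  proof (cases "p > a")
    case True
    then show ?thesis using Cons by auto
  next
    case False
    then have "p = a" using Cons.prems by auto
    then have "filter (\<lambda>p. p > a) ps = []"
      using Cons.prems by (auto simp: filter_empty_conv)
    then show ?thesis using Cons \<open>p = a\<close> by auto
  qed
qed simp

lemma last_gt_iff: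
  assumes "sorted_wrt (\<ge>) (ps :: nat list)"
  shows "(ps \<noteq> [] \<longrightarrow> last ps > j) \<longleftrightarrow> (\<forall>p\<in>set ps. p > j)"
  using assms
proof (induction ps)
  case (Cons p ps)
  then show ?case
    by (cases ps) auto
qed simp

text \<open>Copies of the least value fill the last positions; this translates between the distance
  condition and multiplicities.\<close>

lemma nth_eq_least_iff:
  assumes "sorted_wrt (\<ge>) (qs :: nat list)" "\<forall>q\<in>set qs. q \<ge> a" "s < length qs"
  shows "qs ! s = a \<longleftrightarrow> length qs \<le> s + count_list qs a"
proof -
  let ?f = "filter (\<lambda>p. p > a) qs"
  have qs: "qs = ?f @ replicate (count_list qs a) a"
    by (rule sorted_wrt_ge_replicate[OF assms(1,2)])
  have len: "length qs = length ?f + count_list qs a"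
    by (subst qs) simp
  show ?thesis
  proof (cases "s < length ?f")
    case True
    then have "qs ! s = ?f ! s" by (subst qs) (simp add: nth_append)
    then have "qs ! s > a" using True nth_mem[OF True] by auto
    then show ?thesis using True len by simp
  next
    case False
    then have "qs ! s = a" using assms(3) len by (subst qs) (simp add: nth_append)
    then show ?thesis using False len by simp
  qed
qed

text \<open>Each appended a needs an entry at least a + 2 at distance k - 1 before it. The last one
  is the strictest and leaves at most k - i - 1 final positions of \<open>qs\<close> for a + 1. For
  i = 0 the bound comes from the condition on \<open>qs\<close> itself.\<close>

lemma diff_two_at_distance_append_replicate:
  assumes "sorted_wrt (\<ge>) qs" "\<forall>q\<in>set qs. q > a" "i < k"
  shows "diff_two_at_distance (k - 1) (qs @ replicate i a) \<longleftrightarrow>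
    diff_two_at_distance (k - 1) qs \<and> count_list qs (a + 1) \<le> k - Suc i"
proof (intro iffI conjI)
  let ?ps = "qs @ replicate i a" and ?c = "count_list qs (a + 1)"
  have ge: "\<forall>q\<in>set qs. q \<ge> a + 1" using assms(2) by auto
  {
    assume d: "diff_two_at_distance (k - 1) ?ps"
    then show "diff_two_at_distance (k - 1) qs"
    proof -
      have "qs ! (s + (k - 1)) + 2 \<le> qs ! s" if "s + (k - 1) < length qs" for s
        using d[unfolded diff_two_at_distance_def, rule_format, of s] that
        by (simp add: nth_append)
      then show ?thesis by (simp add: diff_two_at_distance_def)
    qed
    show "?c \<le> k - Suc i"
    proof (rule ccontr)
      assume c: "\<not> ?c \<le> k - Suc i"
      \<comment> \<open>This is the partner of the last position of \<open>?ps\<close>: s + (k - 1)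
        = length qs + i - 1.\<close>
      define s where "s = length qs - (k - i)"
      have "?c \<le> length qs" by (rule count_le_length)
      then have s: "s + (k - i) = length qs" "s < length qs"
        using c assms(3) by (auto simp: s_def)
      have qs: "qs ! s = a + 1"
        using nth_eq_least_iff[OF assms(1) ge s(2)] s c by auto
      show False
      proof (cases "i = 0")
        \<comment> \<open>Here k copies of a + 1 in \<open>qs\<close> give difference 0 at distance
          k - 1.\<close>
        case True
        then have "s + (k - 1) < length qs" "length qs \<le> s + (k - 1) + ?c"
          using s c assms(3) by auto
        then have "qs ! (s + (k - 1)) = a + 1"
          using nth_eq_least_iff[OF assms(1) ge] by blast
        then show False
          using d qs True \<open>s + (k - 1) < length qs\<close> unfolding diff_two_at_distance_def by fastforce
      next
        case False
        then have "s + (k - 1) < length ?ps" "\<not> s + (k - 1) < length qs" "s + (k - 1) - length qs < i"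
          using s assms(3) by auto
        then have "?ps ! (s + (k - 1)) = a" by (simp add: nth_append)
        moreover have "?ps ! s = a + 1" using s qs by (simp add: nth_append)
        ultimately show False
          using d \<open>s + (k - 1) < length ?ps\<close> unfolding diff_two_at_distance_def by fastforce
      qed
    qed
  }
  assume *: "diff_two_at_distance (k - 1) qs \<and> ?c \<le> k - Suc i"
  show "diff_two_at_distance (k - 1) ?ps"
    unfolding diff_two_at_distance_def
  proof (intro allI impI)
    fix s assume s: "s + (k - 1) < length ?ps"
    show "?ps ! (s + (k - 1)) + 2 \<le> ?ps ! s"
    proof (cases "s + (k - 1) < length qs")
      case True
      then show ?thesis using * by (auto simp: diff_two_at_distance_def nth_append)
    next
      case False
      then have "?ps ! (s + (k - 1)) = a" using s by (auto simp: nth_append)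
      \<comment> \<open>Since s + (k - i) \<le> length qs, position s lies before the copies of a +
        1.\<close>
      moreover have "s < length qs" "\<not> length qs \<le> s + ?c"
        using s False assms(3) * by auto
      then have "?ps ! s \<ge> a + 2"
        using nth_eq_least_iff[OF assms(1) ge] assms(2) nth_mem[of s qs]
        by (fastforce simp: nth_append)
      ultimately show ?thesis by simp
    qed
  qed
qed

text \<open>Deleting the i copies of j + 1 is a bijection, and
  \<open>diff_two_at_distance_append_replicate\<close> turns the distance condition into the bound
  on j + 2. The value is 0 when i copies exceed the multiplicity bound or the weight m.\<close>

lemma card_gordon_partitions_eq:
  assumes "i < k"
  shows "card {ps \<in> gordon_partitions k j l m. count_list ps (j + 1) = i} =
    (if k - l < i \<or> m < i * (j + 1) then 0 else card (gordon_partitions k (j + 1) (Suc i) (m - i * (j + 1))))"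
proof -
  let ?A = "{ps \<in> gordon_partitions k j l m. count_list ps (j + 1) = i}"
  let ?B = "gordon_partitions k (j + 1) (Suc i) (m - i * (j + 1))"
  let ?f = "\<lambda>qs. qs @ replicate i (j + 1)"
  have sorted: "sorted_wrt (\<ge>) (?f qs) \<longleftrightarrow> sorted_wrt (\<ge>) qs" if "\<forall>q\<in>set qs. q > j + 1" for qs
  proof -
    have "sorted_wrt (\<ge>) (replicate i (j + 1))" by (induction i) auto
    then show ?thesis using that by (auto simp: sorted_wrt_append less_imp_le)
  qed
  have gp: "qs \<in> gordon_partitions k j' l' m' \<longleftrightarrow> sorted_wrt (\<ge>) qs \<and> (\<forall>q\<in>set qs. q > j') \<and>
      sum_list qs = m' \<and> diff_two_at_distance (k - 1) qs \<and> count_list qs (j' + 1) \<le> k - l'" for qs j' l' m'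
    using last_gt_iff[of qs j'] by (auto simp: gordon_partitions_def partition_of_def)
  have f: "?f qs \<in> ?A \<longleftrightarrow> i \<le> k - l \<and> i * (j + 1) \<le> m \<and> qs \<in> ?B" if "\<forall>q\<in>set qs. q > j + 1" for qs
  proof -
    have "count_list qs (j + 1) = 0"
      using that by (auto simp: count_list_0_iff)
    moreover have "(\<forall>q\<in>set (?f qs). q > j)" using that by auto
    moreover have "count_list (replicate i (j + 1)) (j + 1) = i"
      by (induction i) auto
    ultimately show ?thesis
      using that assms sorted[OF that] diff_two_at_distance_append_replicate[of qs "j + 1" i k]
      by (auto simp: gp sum_list_replicate)
  qed
  have surj: "\<exists>qs. ps = ?f qs \<and> (\<forall>q\<in>set qs. q > j + 1)" if "ps \<in> ?A" for ps
  proof (intro exI conjI)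
    have "sorted_wrt (\<ge>) ps" "\<forall>p\<in>set ps. p \<ge> j + 1" "count_list ps (j + 1) = i"
      using that by (auto simp: gp Suc_le_eq)
    then show "ps = ?f (filter (\<lambda>p. p > j + 1) ps)"
      using sorted_wrt_ge_replicate by blast
  qed auto
  show ?thesis
  proof (cases "k - l < i \<or> m < i * (j + 1)")
    case True
    have "?A = {}"
    proof (rule equals0I)
      fix ps assume ps: "ps \<in> ?A"
      obtain qs where qs: "ps = ?f qs" "\<forall>q\<in>set qs. q > j + 1" using surj[OF ps] by blast
      show False using f[OF qs(2)] ps True unfolding qs(1) by linarith
    qed
    then show ?thesis using True by (simp only: card.empty if_True)
  next
    case False
    have "?A = ?f ` ?B"
    proof (intro set_eqI iffI)
      fix ps assume ps: "ps \<in> ?A"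
      obtain qs where qs: "ps = ?f qs" "\<forall>q\<in>set qs. q > j + 1" using surj[OF ps] by blast
      show "ps \<in> ?f ` ?B" using f[OF qs(2)] ps unfolding qs(1) by blast
    next
      fix ps assume "ps \<in> ?f ` ?B"
      then obtain qs where qs: "ps = ?f qs" "qs \<in> ?B" by blast
      then have "\<forall>q\<in>set qs. q > j + 1" by (simp add: gp)
      then show "ps \<in> ?A"
        using f[of qs] qs(2) False unfolding qs(1) not_le de_Morgan_disj not_less by blast
    qed
    then show ?thesis
      using False by (simp add: card_image inj_on_def)
  qed
qed

section \<open>Generating functions and Gordon's theorem\<close>

definition gordon_gf :: "nat \<Rightarrow> nat \<Rightarrow> nat \<Rightarrow> rat fps" where
  "gordon_gf k j l = Abs_fps (\<lambda>m. of_nat (card (gordon_partitions k j l m)))"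

text \<open>The part j + 1 may occur i times on the left but i - 1 times in the first summand; the
  difference counts partitions with exactly i copies.\<close>

lemma gordon_gf_rec:
  assumes "i < k" "0 < i"
  shows "gordon_gf k j (k - i) = gordon_gf k j (k + 1 - i) +
    fps_X ^ ((j + 1) * i) * gordon_gf k (j + 1) (Suc i)"
proof (rule fps_ext)
  fix m
  let ?A = "{ps \<in> gordon_partitions k j (k - i) m. count_list ps (j + 1) = i}"
  have "gordon_partitions k j (k - i) m = gordon_partitions k j (k + 1 - i) m \<union> ?A"
    "gordon_partitions k j (k + 1 - i) m \<inter> ?A = {}"
    using assms by (auto simp: gordon_partitions_def)
  then have "card (gordon_partitions k j (k - i) m) = card (gordon_partitions k j (k + 1 - i) m) + card ?A"
    by (metis (no_types, lifting) card_Un_disjoint finite_gordon_partitions finite_Un)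
  then show "fps_nth (gordon_gf k j (k - i)) m = fps_nth (gordon_gf k j (k + 1 - i) +
      fps_X ^ ((j + 1) * i) * gordon_gf k (j + 1) (Suc i)) m"
    using assms by (simp only: card_gordon_partitions_eq[OF assms(1)])
      (auto simp: gordon_gf_def fps_X_power_mult_nth mult.commute)
qed

text \<open>For l = k the part j + 1 is forbidden, and the distance condition bounds the copies of j
  + 2 by k - 1.\<close>

lemma gordon_gf_shift:
  assumes "0 < k"
  shows "gordon_gf k j k = gordon_gf k (j + 1) 1"
proof (rule fps_ext)
  fix m
  have "gordon_partitions k j k m = {ps \<in> gordon_partitions k j k m. count_list ps (j + 1) = 0}"
    by (auto simp: gordon_partitions_def)
  then show "fps_nth (gordon_gf k j k) m = fps_nth (gordon_gf k (j + 1) 1) m"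
    using card_gordon_partitions_eq[OF assms, of j k m] by (simp add: gordon_gf_def)
qed

lemma gordon_gf_cong: "fps_cong (j + 1) (gordon_gf k j l) 1"
proof -
  have "gordon_partitions k j l m = (if m = 0 then {[]} else {})" if "m < j + 1" for m
  proof -
    have "ps = []" if "ps \<in> gordon_partitions k j l m" for ps
    proof (rule ccontr)
      assume "ps \<noteq> []"
      then have "j < last ps" "last ps \<le> sum_list ps" "sum_list ps = m"
        using that by (auto simp: gordon_partitions_def partition_of_def intro: member_le_sum_list)
      then show False using \<open>m < j + 1\<close> by simp
    qed
    moreover have "[] \<in> gordon_partitions k j l m \<longleftrightarrow> m = 0"
      by (auto simp: gordon_partitions_def partition_of_def diff_two_at_distance_def)
    ultimately show ?thesis by auto
  qed
  then show ?thesis by (simp add: fps_cong_def gordon_gf_def)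
qed

text \<open>Gordon's theorem: \<open>andrews_sum\<close> and \<open>?E\<close> times the generating
  function solve the same recursion and agree to order \<open>min N (j + 1)\<close>, so
  \<open>recursion_solution_unique\<close> identifies them modulo q^N.\<close>

lemma gordon_product_eq_gordon_gf:
  assumes "1 \<le> i" "i \<le> k"
  shows "gordon_product k (k + 1 - i) = gordon_gf k 0 (k + 1 - i)"
proof (rule fps_eqI_cong)
  fix N
  let ?E = "qpoch fps_X N 0 :: rat fps"
  \<comment> \<open>The value 0 at i = 0 makes that case of the recursion \<open>R\<close> read as
    \<open>gordon_gf_shift\<close>.\<close>
  define R where "R j i = (if i = 0 then 0 else gordon_gf k j (k + 1 - i))" for j i
  have R: "R j (Suc i) = R j i + fps_X ^ ((j + 1) * i) * R (j + 1) (k - i)" if "i < k" for j i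
    using that gordon_gf_rec[of i k j] gordon_gf_shift[of k j] by (auto simp: R_def Suc_diff_le)
  define D where "D j i = andrews_sum k N j i - ?E * R j i" for j i
  have "fps_cong N (D 0 i) 0"
  proof (rule recursion_solution_unique[where k = k])
    fix j i assume "i < k"
    from fps_cong_diff[OF andrews_sum_rec[OF this] fps_cong_refl, of N j "?E * R j (Suc i)"]
    show "fps_cong N (D j (Suc i)) (D j i + fps_X ^ ((j + 1) * i) * D (j + 1) (k - i))"
      by (simp add: D_def R[OF \<open>i < k\<close>] algebra_simps)
  next
    fix j i assume i: "1 \<le> i" "i \<le> k"
    have "fps_cong (min N (j + 1)) (?E * R j i) (?E * 1)"
      using fps_cong_mono[OF gordon_gf_cong[of j k "k + 1 - i"], of "min N (j + 1)"] i
      by (intro fps_cong_mult_left) (simp add: R_def)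
    from fps_cong_diff[OF andrews_sum_cong[OF i] this]
    show "fps_cong (min N (j + 1)) (D j i) 0" by (simp add: D_def)
  qed (use assms in \<open>simp_all add: D_def R_def\<close>)
  from fps_cong_add[OF this fps_cong_refl, of "?E * R 0 i"]
  have "fps_cong N (andrews_sum k N 0 i) (?E * gordon_gf k 0 (k + 1 - i))"
    using assms by (simp add: D_def R_def)
  with gordon_product_andrews_sum[OF assms, of N]
  have "fps_cong N (?E * gordon_product k (k + 1 - i)) (?E * gordon_gf k 0 (k + 1 - i))"
    by (rule fps_cong_trans)
  then show "fps_cong N (gordon_product k (k + 1 - i)) (gordon_gf k 0 (k + 1 - i))"
    by (rule fps_cong_cancel) (use fps_nth_qpoch_0[of 1 N, where 'a = rat] in simp)
qed

theorem theorem4p1: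
  fixes k :: nat and G :: "nat \<Rightarrow> rat fls"
  assumes "k \<ge> 2"
    and "\<forall>i\<in>{1..k}. G i = fps_to_fls (gordon_product k i)"
    and "\<forall>j\<ge>1. \<forall>i\<in>{2..k}. G ((k - 1) * j + i) =
           (G ((k - 1) * (j - 1) + k - i + 1) - G ((k - 1) * (j - 1) + k - i + 2))
             / fls_X ^ ((i - 1) * j)"
  shows "\<forall>j. \<forall>l\<in>{1..k}. G ((k - 1) * j + l) =
           fps_to_fls (Abs_fps (\<lambda>m. of_nat (card (gordon_partitions k j l m))))"
proof -
  have "G ((k - 1) * j + l) = fps_to_fls (gordon_gf k j l)" if "l \<in> {1..k}" for j l
    using that
  proof (induction j arbitrary: l)
    case 0
    then have "gordon_product k l = gordon_gf k 0 l"
      using gordon_product_eq_gordon_gf[of "k + 1 - l" k] by force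
    then show ?case using 0 assms(2) by simp
  next
    case (Suc j)
    show ?case
    proof (cases "l = 1")
      \<comment> \<open>This index coincides with that of (j, k), so the previous row supplies the
        value.\<close>
      case True
      have "(k - 1) * Suc j + 1 = (k - 1) * j + k"
        using assms(1) by simp
      then show ?thesis
        using Suc.IH[of k] gordon_gf_shift[of k j] True assms(1) by (simp add: add.commute)
    next
      case False
      define i where "i = l - 1"
      have i: "l = Suc i" "0 < i" "i < k"
        using False Suc.prems by (auto simp: i_def)
      have "G ((k - 1) * Suc j + l) = (G ((k - 1) * j + k - l + 1) - G ((k - 1) * j + k - l + 2))
          / fls_X ^ (i * Suc j)"
        using assms(3)[rule_format, of "Suc j" l] i by simp
      also have "(k - 1) * j + k - l + 1 = (k - 1) * j + (k - i)"
        using i by simp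
      also have "(k - 1) * j + k - l + 2 = (k - 1) * j + (k + 1 - i)"
        using i by simp
      also have "G ((k - 1) * j + (k - i)) = fps_to_fls (gordon_gf k j (k - i))"
        using i by (intro Suc.IH) auto
      also have "G ((k - 1) * j + (k + 1 - i)) = fps_to_fls (gordon_gf k j (k + 1 - i))"
        using i by (intro Suc.IH) auto
      \<comment> \<open>The difference is an exact multiple of the divisor, so the Laurent quotient
        is a power series.\<close>
      also have "fps_to_fls (gordon_gf k j (k - i)) - fps_to_fls (gordon_gf k j (k + 1 - i)) =
          fls_X ^ (i * Suc j) * fps_to_fls (gordon_gf k (Suc j) l)"
        by (subst gordon_gf_rec[OF i(3,2)])
           (simp add: i(1) fls_times_fps_to_fls fps_to_fls_power mult.commute[of i])
      finally show ?thesis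
        by (simp only: nonzero_mult_div_cancel_left[OF power_not_zero[OF fls_X_nonzero]])
    qed
  qed
  then show ?thesis by (simp add: gordon_gf_def)
qed

end
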